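(* For every triple $(r,s,t)$ of positive integers, the set of orders of the finite quotients of the full triangle group $\Delta(r,s,t)$ has natural density zero; that is, if $\mathcal{F}$ denotes the set of positive integers $n$ such that $\Delta(r,s,t)$ has a finite quotient of order $n$, then $$\lim_{x\to\infty}\frac{|\mathcal{F}\cap\{1,\dots,x\}|}{x}=0.$$
   Context: For positive integers $r,s,t$, the full triangle group is the group with presentation $\Delta(r,s,t)=\langle\, a,b,c\mid a^2=b^2=c^2=(ab)^r=(bc)^s=(ac)^t=1\,\rangle$. A finite quotient of a group is any finite group that is a homomorphic image of it. For a set $S$ of positive integers, put $d_x(S)=|S\cap\{1,\dots,x\}|/x$; the natural density of $S$ is $\lim_{x\to\infty}d_x(S)$ when this limit exists. *)

theory Defs
  imports Complex_Main "HOL-Algebra.Coset"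
begin

section \<open>Groups given by generators and relators\<close>

text \<open>A letter \<open>(x, True)\<close> stands for the generator \<open>x\<close>, and \<open>(x, False)\<close> for its formal inverse.
  All elements of the type \<open>'g\<close> are generators.\<close>

type_synonym 'g word = "('g \<times> bool) list"

inductive word_eq :: "'g word set \<Rightarrow> 'g word \<Rightarrow> 'g word \<Rightarrow> bool" for R where
  refl: "word_eq R u u"
| sym: "word_eq R u v \<Longrightarrow> word_eq R v u"
| trans: "word_eq R u v \<Longrightarrow> word_eq R v w \<Longrightarrow> word_eq R u w"
| cancel: "word_eq R (u @ [(x, e), (x, \<not> e)] @ v) (u @ v)"
| relator: "r \<in> R \<Longrightarrow> word_eq R (u @ r @ v) (u @ v)"

definition word_rel :: "'g word set \<Rightarrow> ('g word \<times> 'g word) set" where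
  "word_rel R = {(u, v). word_eq R u v}"

definition presented_group :: "'g word set \<Rightarrow> 'g word set monoid" where
  "presented_group R =
    \<lparr>carrier = UNIV // word_rel R,
     mult = (\<lambda>U V. \<Union>u\<in>U. \<Union>v\<in>V. word_rel R `` {u @ v}),
     one = word_rel R `` {[]}\<rparr>"

lemma equiv_word_rel: "equiv UNIV (word_rel R)"
  by (rule equivI)
    (auto simp: word_rel_def refl_on_def sym_def trans_def intro: word_eq.intros)

lemma word_eq_append_left: "word_eq R u v \<Longrightarrow> word_eq R (w @ u) (w @ v)"
proof (induction rule: word_eq.induct)
  case (cancel u x e v)
  show ?case using word_eq.cancel[of R "w @ u" x e v] by simp
next
  case (relator r u v)
  then show ?case using word_eq.relator[of r R "w @ u" v] by simp
qed (blast intro: word_eq.intros)+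

lemma word_eq_append_right: "word_eq R u v \<Longrightarrow> word_eq R (u @ w) (v @ w)"
proof (induction rule: word_eq.induct)
  case (cancel u x e v)
  show ?case using word_eq.cancel[of R u x e "v @ w"] by simp
next
  case (relator r u v)
  then show ?case using word_eq.relator[of r R u "v @ w"] by simp
qed (blast intro: word_eq.intros)+

lemma word_eq_append:
  assumes "word_eq R u u'" "word_eq R v v'"
  shows "word_eq R (u @ v) (u' @ v')"
  using assms by (meson word_eq.trans word_eq_append_left word_eq_append_right)

lemma word_class_eq_iff: "word_rel R `` {u} = word_rel R `` {v} \<longleftrightarrow> word_eq R u v"
  using eq_equiv_class_iff[OF equiv_word_rel, of u v R] by (simp add: word_rel_def)

lemma carrier_presented_group: "carrier (presented_group R) = range (\<lambda>u. word_rel R `` {u})"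
  by (auto simp: presented_group_def quotient_def)

lemma one_presented_group: "\<one>\<^bsub>presented_group R\<^esub> = word_rel R `` {[]}"
  by (simp add: presented_group_def)

lemma mult_presented_group:
  "word_rel R `` {u} \<otimes>\<^bsub>presented_group R\<^esub> word_rel R `` {v} = word_rel R `` {u @ v}"
proof -
  have *: "word_rel R `` {u' @ v'} = word_rel R `` {u @ v}"
    if "u' \<in> word_rel R `` {u}" "v' \<in> word_rel R `` {v}" for u' v'
    using that by (metis CollectD Image_singleton_iff case_prodD word_class_eq_iff
        word_eq_append word_rel_def)
  have "u \<in> word_rel R `` {u}" "v \<in> word_rel R `` {v}"
    by (auto simp: word_rel_def intro: word_eq.refl)
  then have ne: "word_rel R `` {u} \<noteq> {}" "word_rel R `` {v} \<noteq> {}" by blast+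
  have "word_rel R `` {u} \<otimes>\<^bsub>presented_group R\<^esub> word_rel R `` {v} =
      (\<Union>u'\<in>word_rel R `` {u}. \<Union>v'\<in>word_rel R `` {v}. word_rel R `` {u' @ v'})"
    by (simp add: presented_group_def)
  also have "\<dots> = (\<Union>u'\<in>word_rel R `` {u}. \<Union>v'\<in>word_rel R `` {v}. word_rel R `` {u @ v})"
    by (intro SUP_cong HOL.refl *)
  also have "\<dots> = word_rel R `` {u @ v}" using ne by (simp only: UN_constant if_False)
  finally show ?thesis .
qed

lemma word_eq_inverse: "word_eq R (map (\<lambda>(x, e). (x, \<not> e)) (rev w) @ w) []"
proof (induction w)
  case Nil
  show ?case by (simp add: word_eq.refl)
next
  case (Cons l w)
  obtain x e where l: "l = (x, e)" by fastforce
  have "word_eq R (map (\<lambda>(x, e). (x, \<not> e)) (rev (l # w)) @ l # w)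
          (map (\<lambda>(x, e). (x, \<not> e)) (rev w) @ w)"
    using word_eq.cancel[of R "map (\<lambda>(x, e). (x, \<not> e)) (rev w)" x "\<not> e" w] by (simp add: l)
  then show ?case using Cons.IH by (rule word_eq.trans)
qed

theorem group_presented_group: "group (presented_group R)"
proof (rule groupI)
  fix X assume "X \<in> carrier (presented_group R)"
  then obtain w where "X = word_rel R `` {w}" by (auto simp: carrier_presented_group)
  then show "\<exists>Y\<in>carrier (presented_group R). Y \<otimes>\<^bsub>presented_group R\<^esub> X = \<one>\<^bsub>presented_group R\<^esub>"
    by (auto simp: carrier_presented_group mult_presented_group one_presented_group
        word_class_eq_iff intro!: exI[of _ "map (\<lambda>(x, e). (x, \<not> e)) (rev w)"] word_eq_inverse)
qed (auto simp: carrier_presented_group mult_presented_group one_presented_group)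

text \<open>Mapping property: an assignment of the generators that kills the relators extends to a
  homomorphism.\<close>

definition eval_word :: "('h, 'm) monoid_scheme \<Rightarrow> ('g \<Rightarrow> 'h) \<Rightarrow> 'g word \<Rightarrow> 'h" where
  "eval_word H f w = foldr (\<lambda>(x, e) y. (if e then f x else inv\<^bsub>H\<^esub> f x) \<otimes>\<^bsub>H\<^esub> y) w \<one>\<^bsub>H\<^esub>"

theorem presented_group_hom_extension:
  assumes "group H" and f: "\<And>x. f x \<in> carrier H"
    and R: "\<And>r. r \<in> R \<Longrightarrow> eval_word H f r = \<one>\<^bsub>H\<^esub>"
  shows "\<exists>h \<in> hom (presented_group R) H. \<forall>x. h (word_rel R `` {[(x, True)]}) = f x"
proof -
  interpret H: group H by fact
  have closed: "eval_word H f w \<in> carrier H" for w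
    by (induction w) (auto simp: eval_word_def f)
  have append: "eval_word H f (u @ v) = eval_word H f u \<otimes>\<^bsub>H\<^esub> eval_word H f v" for u v
  proof (induction u)
    case Nil
    show ?case using closed[of v] by (simp add: eval_word_def)
  next
    case (Cons l u)
    then show ?case using closed[of u] closed[of v]
      by (cases l) (auto simp: eval_word_def f H.m_assoc)
  qed
  have inv: "eval_word H f [(x, e), (x, \<not> e)] = \<one>\<^bsub>H\<^esub>" for x e
    by (cases e) (auto simp: eval_word_def f)
  have cong: "eval_word H f u = eval_word H f v" if "word_eq R u v" for u v
    using that
  proof (induction rule: word_eq.induct)
    case (cancel u x e v)
    show ?case using closed by (simp only: append inv H.l_one)
  next
    case (relator r u v)
    then show ?case using closed by (simp add: append R)
  qed auto
  define h where "h X = eval_word H f (SOME w. w \<in> X)" for X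
  have h: "h (word_rel R `` {w}) = eval_word H f w" for w
  proof -
    have "w \<in> word_rel R `` {w}" by (auto simp: word_rel_def intro: word_eq.refl)
    then have "(SOME v. v \<in> word_rel R `` {w}) \<in> word_rel R `` {w}" by (rule someI)
    then show ?thesis using cong unfolding h_def by (auto simp: word_rel_def)
  qed
  have "h \<in> hom (presented_group R) H"
    by (rule homI) (auto simp: carrier_presented_group mult_presented_group h closed append)
  moreover have "h (word_rel R `` {[(x, True)]}) = f x" for x
    by (simp add: h) (simp add: eval_word_def f)
  ultimately show ?thesis by blast
qed


section \<open>Full triangle groups\<close>

datatype tri_gen = gen_a | gen_b | gen_c

definition word_power :: "'g word \<Rightarrow> nat \<Rightarrow> 'g word" where
  "word_power w n = concat (replicate n w)"

definition triangle_relators :: "nat \<Rightarrow> nat \<Rightarrow> nat \<Rightarrow> tri_gen word set" where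
  "triangle_relators r s t =
    (let a = (gen_a, True); b = (gen_b, True); c = (gen_c, True) in
     {word_power [a] 2, word_power [b] 2, word_power [c] 2,
      word_power [a, b] r, word_power [b, c] s, word_power [a, c] t})"

definition full_triangle_group :: "nat \<Rightarrow> nat \<Rightarrow> nat \<Rightarrow> tri_gen word set monoid" where
  "full_triangle_group r s t = presented_group (triangle_relators r s t)"


section \<open>Orders of finite quotients\<close>

text \<open>Carriers in \<open>nat\<close> suffice, since every finite group has an isomorphic copy there; the lemma
  \<open>finite_quotient_ordersI\<close> below admits quotients over an arbitrary type.\<close>

definition finite_quotient_orders :: "('a, 'm) monoid_scheme \<Rightarrow> nat set" where
  "finite_quotient_orders G =
    {n. \<exists>(Q :: nat monoid) f. group Q \<and> finite (carrier Q) \<and> f \<in> epi G Q \<and> order Q = n}"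

lemma finite_quotient_ordersI:
  fixes Q :: "('b, 'k) monoid_scheme"
  assumes "group Q" "finite (carrier Q)" "f \<in> epi G Q"
  shows "order Q \<in> finite_quotient_orders G"
proof -
  interpret Q: group Q by fact
  obtain g :: "'b \<Rightarrow> nat" where g: "inj_on g (carrier Q)"
    using finite_imp_inj_to_nat_seg[OF assms(2)] by blast
  define k where "k = the_inv_into (carrier Q) g"
  have k: "k (g x) = x" if "x \<in> carrier Q" for x
    using that g by (simp add: k_def the_inv_into_f_f)
  define Q' :: "nat monoid" where
    "Q' = \<lparr>carrier = g ` carrier Q, mult = (\<lambda>x y. g (k x \<otimes>\<^bsub>Q\<^esub> k y)), one = g \<one>\<^bsub>Q\<^esub>\<rparr>"
  have "group Q'"
  proof (rule groupI)
    fix x assume "x \<in> carrier Q'"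
    then obtain y where "y \<in> carrier Q" "x = g y" by (auto simp: Q'_def)
    then show "\<exists>z\<in>carrier Q'. z \<otimes>\<^bsub>Q'\<^esub> x = \<one>\<^bsub>Q'\<^esub>"
      by (intro bexI[of _ "g (inv\<^bsub>Q\<^esub> y)"]) (auto simp: Q'_def k)
  qed (auto simp: Q'_def k Q.m_assoc)
  moreover have "finite (carrier Q')" using assms(2) by (simp add: Q'_def)
  moreover have "g \<circ> f \<in> epi G Q'"
  proof -
    have f: "f \<in> hom G Q" "f ` carrier G = carrier Q" using assms(3) by (auto simp: epi_def)
    then have "g \<circ> f \<in> hom G Q'"
      by (auto simp: hom_def Q'_def k Pi_iff)
    moreover have "(g \<circ> f) ` carrier G = carrier Q'"
      unfolding image_comp[symmetric] f(2) by (simp add: Q'_def)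
    ultimately show ?thesis by (simp add: epi_def)
  qed
  moreover have "order Q' = order Q" using g by (simp add: order_def Q'_def card_image)
  ultimately show ?thesis unfolding finite_quotient_orders_def by blast
qed


section \<open>Natural density\<close>

definition has_natural_density :: "nat set \<Rightarrow> real \<Rightarrow> bool" where
  "has_natural_density S d \<longleftrightarrow> (\<lambda>x::nat. real (card (S \<inter> {1..x})) / real x) \<longlonglongrightarrow> d"

end

theory Submission
  imports Defs "HOL-Algebra.Sylow" "HOL-Algebra.Group_Action" "HOL-Algebra.Multiplicative_Group"
    "HOL-Number_Theory.Cong" "HOL-Real_Asymp.Real_Asymp"
begin

text \<open>
  Let \<open>p > max {2, r, s, t}\<close> be a prime that divides \<open>n\<close> exactly once, and suppose that no divisor
  \<open>d \<noteq> 1\<close> of \<open>n\<close> is congruent to 1 modulo \<open>p\<close>. In a quotient of order \<open>n\<close>, a subgroup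
  \<open>P\<close> of order \<open>p\<close> fixes no conjugate of \<open>P\<close> but itself, so the number of conjugates is 1 modulo \<open>p\<close>
  and divides \<open>n\<close>; hence \<open>P\<close> is normal. A twisted transfer into
  \<open>P\<close> is a crossed homomorphism to \<open>\<int>/p\<close> that does not vanish on \<open>P\<close>; but on a group generated by involutions whose pairwise products have order prime
  to \<open>p\<close>, every such crossed homomorphism is principal and hence vanishes on \<open>P\<close>. So \<open>n\<close> is not
  the order of a quotient.

  Almost every \<open>n \<le> x\<close> has such a prime \<open>p > y = (ln x)\<^sup>2\<close>: few \<open>n\<close> are \<open>y\<close>-smooth because the
  \<open>y\<close>-smooth part of \<open>n\<close> has average logarithm \<open>O((ln y)\<^sup>2)\<close>, and the \<open>n\<close> divisible by some \<open>p\<^sup>2\<close>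
  or by some \<open>p (1 + k p)\<close> with \<open>p > y\<close> and \<open>k \<ge> 1\<close> number at most \<open>x (2 + ln x) / y\<close>.
\<close>

section \<open>Normal subgroups of prime order\<close>

text \<open>Distinct subgroups of prime order \<open>p\<close> meet trivially. As \<open>P\<close>
  normalizes \<open>Q\<close>, their product set would then be a subgroup with
  \<open>p\<^sup>2\<close> elements, against Lagrange.\<close>

lemma (in group) subgroup_eq_if_normalizes:
  assumes fin: "finite (carrier G)" and p: "prime p"
    and P: "subgroup P G" "card P = p" and Q: "subgroup Q G" "card Q = p"
    and norm: "\<And>x q. x \<in> P \<Longrightarrow> q \<in> Q \<Longrightarrow> x \<otimes> q \<otimes> inv x \<in> Q"
    and np: "\<not> p\<^sup>2 dvd order G"
  shows "P = Q"
proof (rule ccontr)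
  assume "P \<noteq> Q"
  note Pc = subgroup.mem_carrier[OF P(1)] and Qc = subgroup.mem_carrier[OF Q(1)]
  have finP: "finite P" "finite Q"
    using fin P(1) Q(1) finite_subset subgroup.subset by blast+
  have sub: "subgroup (P \<inter> Q) (G\<lparr>carrier := P\<rparr>)"
    using P(1) Q(1) by (simp add: subgroup_incl subgroups_Inter_pair)
  have "group (G\<lparr>carrier := P\<rparr>)" using P(1) by (rule subgroup_imp_group)
  then have "card (P \<inter> Q) dvd p"
    using group.lagrange[OF _ sub] P(2) by (auto simp: order_def intro: dvdI[of _ _ "card (rcosets\<^bsub>G\<lparr>carrier := P\<rparr>\<^esub> (P \<inter> Q))"])
  moreover have "card (P \<inter> Q) \<noteq> p"
    using \<open>P \<noteq> Q\<close> finP P(2) Q(2) by (metis card_subset_eq inf_le1 inf_le2)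
  ultimately have "card (P \<inter> Q) = 1" using p by (metis One_nat_def prime_nat_iff)
  then have triv: "P \<inter> Q = {\<one>}"
    using P(1) Q(1) by (metis IntI card_1_singletonE singletonD subgroup.one_closed)
  have norm': "inv x \<otimes> q \<otimes> x \<in> Q" if "x \<in> P" "q \<in> Q" for x q
    using norm[of "inv x" q] that P(1) by (simp add: subgroup.m_inv_closed subgroup.mem_carrier)
  let ?K = "(\<lambda>(x, q). x \<otimes> q) ` (P \<times> Q)"
  have "subgroup ?K G"
  proof (rule subgroupI)
    show "?K \<subseteq> carrier G" using Pc Qc by auto
    show "?K \<noteq> {}" using P(1) Q(1) subgroup.one_closed by blast
  next
    fix a assume "a \<in> ?K"
    then obtain x q where a: "a = x \<otimes> q" and xq: "x \<in> P" "q \<in> Q" by auto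
    have "inv a = inv x \<otimes> (x \<otimes> inv q \<otimes> inv x)"
      using xq Pc Qc by (simp add: a inv_mult_group m_assoc[symmetric])
    moreover have "inv x \<in> P" "x \<otimes> inv q \<otimes> inv x \<in> Q"
      using xq norm P(1) Q(1) by (simp_all add: subgroup.m_inv_closed)
    ultimately show "inv a \<in> ?K" by (intro image_eqI[of _ _ "(inv x, x \<otimes> inv q \<otimes> inv x)"]) auto
  next
    fix a b assume "a \<in> ?K" "b \<in> ?K"
    then obtain x q y r where ab: "a = x \<otimes> q" "b = y \<otimes> r"
      and xq: "x \<in> P" "q \<in> Q" "y \<in> P" "r \<in> Q" by auto
    \<comment> \<open>Moving \<open>q\<close> past \<open>y\<close> replaces it by a conjugate,
      which stays in \<open>Q\<close> because \<open>P\<close> normalizes \<open>Q\<close>.\<close>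
    have "y \<otimes> ((inv y \<otimes> q \<otimes> y) \<otimes> r) = q \<otimes> (y \<otimes> r)"
      using xq Pc Qc by (simp add: m_assoc[symmetric])
    then have "a \<otimes> b = (x \<otimes> y) \<otimes> ((inv y \<otimes> q \<otimes> y) \<otimes> r)"
      using xq Pc Qc by (simp add: ab m_assoc)
    moreover have "x \<otimes> y \<in> P" "(inv y \<otimes> q \<otimes> y) \<otimes> r \<in> Q"
      using xq norm' P(1) Q(1) by (simp_all add: subgroup.m_closed)
    ultimately show "a \<otimes> b \<in> ?K"
      by (intro image_eqI[of _ _ "(x \<otimes> y, inv y \<otimes> q \<otimes> y \<otimes> r)"]) auto
  qed
  then have "card ?K dvd order G" by (metis lagrange dvd_triv_right)
  moreover have "inj_on (\<lambda>(x, q). x \<otimes> q) (P \<times> Q)"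
  proof (rule inj_onI, clarify)
    fix x q y r assume xq: "x \<in> P" "q \<in> Q" "y \<in> P" "r \<in> Q" and eq: "x \<otimes> q = y \<otimes> r"
    have "inv y \<otimes> x = inv y \<otimes> (x \<otimes> q) \<otimes> inv q" using xq Pc Qc by (simp add: m_assoc)
    also have "\<dots> = r \<otimes> inv q" using xq Pc Qc by (simp add: eq flip: m_assoc)
    finally have "inv y \<otimes> x = r \<otimes> inv q" .
    moreover have "inv y \<otimes> x \<in> P" "r \<otimes> inv q \<in> Q"
      using xq P(1) Q(1) by (simp_all add: subgroup.m_closed subgroup.m_inv_closed)
    ultimately have "inv y \<otimes> x = \<one>" "r \<otimes> inv q = \<one>" using triv by auto
    then show "x = y \<and> q = r"
      using xq Pc Qc by (metis inv_closed inv_equality inv_inv)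
  qed
  ultimately show False
    using np P(2) Q(2) by (simp add: card_image card_cartesian_product power2_eq_square)
qed

text \<open>This is Sylow's count of conjugates. \<open>P\<close> acts by conjugation on its
  conjugacy class \<open>X\<close>, with orbits of size 1 or \<open>p\<close>; by the previous lemma
  \<open>P\<close> is the only fixed point, so \<open>card X\<close> is 1 modulo \<open>p\<close>.
  It also divides \<open>order G\<close>, and the condition on divisors leaves only
  \<open>card X = 1\<close>.\<close>

lemma (in group) normal_if_no_divisor_cong_1:
  assumes fin: "finite (carrier G)" and p: "prime p" and P: "subgroup P G" "card P = p"
    and np: "\<not> p\<^sup>2 dvd order G"
    and div: "\<And>d. d dvd order G \<Longrightarrow> [d = 1] (mod p) \<Longrightarrow> d = 1"
  shows "P \<lhd> G"
proof -
  define E where "E = {H. subgroup H G}"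
  define \<phi> where "\<phi> = (\<lambda>g. \<lambda>H \<in> {H. subgroup H G}. g <# H #> inv g)"
  interpret act: group_action G E \<phi>
    unfolding E_def \<phi>_def by (rule action_by_conjugation_on_subgroups_set)
  interpret Pact: group_action "G\<lparr>carrier := P\<rparr>" E \<phi>
    by (rule act.induced_action[OF P(1)])
  define X where "X = orbit G \<phi> P"
  have PE: "P \<in> E" using P by (simp add: E_def)
  have phi: "\<phi> g H = (\<lambda>h. g \<otimes> h \<otimes> inv g) ` H" if "H \<in> E" for g H
    using that by (auto simp: \<phi>_def E_def l_coset_def r_coset_def)
  have cX: "card X dvd order G"
    using act.orbit_stabilizer_theorem[OF PE] by (metis X_def dvd_triv_left)
  have finX: "finite X"
    using fin by (auto simp: X_def orbit_def)
  have XE: "Q \<in> E" if "Q \<in> X" for Q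
    using that PE act.element_image by (auto simp: X_def orbit_def)
  have X_conj: "\<exists>g\<in>carrier G. Q = \<phi> g P" if "Q \<in> X" for Q
    using that by (auto simp: X_def orbit_def)
  have Xcard: "card Q = p" if "Q \<in> X" for Q
  proof -
    obtain g where g: "g \<in> carrier G" "Q = \<phi> g P" using X_conj[OF \<open>Q \<in> X\<close>] by metis
    have "inj_on (\<lambda>h. g \<otimes> h \<otimes> inv g) P"
      using g(1) subgroup.mem_carrier[OF P(1)] by (auto intro!: inj_onI)
    then show ?thesis using g phi[OF PE] P(2) by (simp add: card_image)
  qed
  have PX: "P \<in> X" using act.orbit_refl[OF PE] by (simp add: X_def)
  let ?orb = "orbit (G\<lparr>carrier := P\<rparr>) \<phi>"
  have orb_X: "?orb Q \<subseteq> X" if Q: "Q \<in> X" for Q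
  proof
    fix R assume "R \<in> ?orb Q"
    then have "R \<in> orbit G \<phi> Q"
      using subgroup.mem_carrier[OF P(1)] by (auto simp: orbit_def)
    then show "R \<in> X"
      using act.orbit_trans[OF PE XE[OF Q] _ _ \<open>R \<in> orbit G \<phi> Q\<close>] Q act.element_image XE[OF Q]
      unfolding X_def orbit_def by blast
  qed
  have one: "Q = P" if Q: "Q \<in> X" and c: "card (?orb Q) = 1" for Q
  proof -
    have "?orb Q = {Q}"
      using c Pact.orbit_refl[OF XE[OF Q]] by (metis card_1_singletonE singletonD)
    then have "\<phi> x Q = Q" if "x \<in> P" for x
      using that by (auto simp: orbit_def)
    then have "x \<otimes> q \<otimes> inv x \<in> Q" if "x \<in> P" "q \<in> Q" for x q
      using that phi[OF XE[OF Q]] by blast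
    then show ?thesis
      using subgroup_eq_if_normalizes[OF fin p P _ Xcard[OF Q] _ np] XE[OF Q]
      by (auto simp: E_def)
  qed
  have orbP: "?orb P = {P}"
  proof -
    have "\<phi> x P = P" if x: "x \<in> P" for x
    proof -
      have "\<phi> x P \<subseteq> P" using x P(1) by (auto simp: phi[OF PE] subgroup.m_closed subgroup.m_inv_closed)
      moreover have "finite P" using P p by (metis card.infinite not_prime_0)
      \<comment> \<open>Members of \<open>X\<close> all have \<open>p\<close> elements, which turns
        the inclusion of \<open>\<phi> x P\<close> in \<open>P\<close> into an equality.\<close>
      moreover have "\<phi> x P \<in> X" using x subgroup.mem_carrier[OF P(1)] by (auto simp: X_def orbit_def)
      ultimately show ?thesis using Xcard P(2) by (metis card_subset_eq)
    qed
    then show ?thesis using P(1) by (auto simp: orbit_def intro: subgroup.one_closed)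
  qed
  have "p dvd card (\<Union>(?orb ` (X - {P})))"
  proof (rule dvd_partition)
    have eq: "\<Union>(?orb ` (X - {P})) \<subseteq> X" using orb_X by blast
    show "finite (\<Union>(?orb ` (X - {P})))" using eq finX by (rule finite_subset)
    show "\<forall>c\<in>?orb ` (X - {P}). p dvd card c"
    proof
      fix c assume "c \<in> ?orb ` (X - {P})"
      then obtain Q where Q: "Q \<in> X" "Q \<noteq> P" and c: "c = ?orb Q" by blast
      have "card (?orb Q) dvd p"
        using Pact.orbit_stabilizer_theorem[OF XE[OF Q(1)]] P(2)
        by (auto simp: order_def intro: dvdI)
      then show "p dvd card c" unfolding c using one[OF Q(1)] Q(2) p by (metis dvd_refl prime_nat_iff)
    qed
    show "\<forall>c1\<in>?orb ` (X - {P}). \<forall>c2\<in>?orb ` (X - {P}). c1 \<noteq> c2 \<longrightarrow> c1 \<inter> c2 = {}"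
      using Pact.disjoint_union XE unfolding orbits_def by blast
  qed
  moreover have "\<Union>(?orb ` (X - {P})) = X - {P}"
  proof
    show "X - {P} \<subseteq> \<Union>(?orb ` (X - {P}))" using Pact.orbit_refl XE by blast
    show "\<Union>(?orb ` (X - {P})) \<subseteq> X - {P}"
    proof
      fix R assume "R \<in> \<Union>(?orb ` (X - {P}))"
      then obtain Q where Q: "Q \<in> X" "Q \<noteq> P" "R \<in> ?orb Q" by auto
      \<comment> \<open>An orbit through \<open>P\<close> is the orbit of \<open>P\<close>, which is
        \<open>{P}\<close>, so its base point \<open>Q\<close> would be \<open>P\<close>.\<close>
      have "R \<noteq> P" using Pact.orbit_sym[OF XE[OF Q(1)] PE] Q orbP by auto
      then show "R \<in> X - {P}" using orb_X Q by auto
    qed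
  qed
  ultimately have "p dvd card X - 1" using PX finX by simp
  then obtain m where "card X - 1 = p * m" by (rule dvdE)
  moreover have "card X \<ge> 1" using PX finX by (metis One_nat_def Suc_leI card_gt_0_iff empty_iff)
  ultimately have "card X = 1 + p * m" by simp
  then have "[card X = 1] (mod p)" using cong_add_lcancel_0_nat[of 1 "p * m" p] by (simp add: cong_0_iff)
  then have "card X = 1" using div cX by blast
  then have "X = {P}" using PX by (metis card_1_singletonE singletonD)
  then have "\<phi> g P = P" if "g \<in> carrier G" for g
    using that by (auto simp: X_def orbit_def)
  then show ?thesis
    using phi[OF PE] P(1) unfolding normal_inv_iff by blast
qed

section \<open>The twisted transfer\<close>

text \<open>Any nontrivial element of a group of prime order generates it. With \<open>z\<close>
  fixed, elements of \<open>P\<close> become exponents modulo \<open>p\<close>, and identities in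
  \<open>P\<close> become congruences.\<close>

lemma (in group) subgroup_prime_card_powers:
  assumes p: "prime p" and P: "subgroup P G" "card P = p"
  obtains z where "z \<in> P" "ord z = p" "P = range (\<lambda>n::nat. z [^] n)"
proof -
  interpret P: subgroup P G by fact
  interpret PG: group "G\<lparr>carrier := P\<rparr>" by (rule subgroup_imp_group) fact
  have finP: "finite P" using P(2) p by (metis card.infinite not_prime_0)
  have "P \<noteq> {\<one>}" using P(2) p by auto
  then obtain z where z: "z \<in> P" "z \<noteq> \<one>" using P.one_closed by blast
  have "z [^] p = \<one>"
    using PG.pow_order_eq_1[of z] z(1) P(2) by (simp add: order_def nat_pow_def)
  then have "ord z dvd p" using z by (simp add: pow_eq_id)
  moreover have "ord z \<noteq> 1" using ord_eq_1[of z] z P.mem_carrier by auto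
  ultimately have ord: "ord z = p" using p by (metis prime_nat_iff)
  have pow: "z [^] n \<in> P" for n :: nat
    using z(1) by (induction n) auto
  have "card ((\<lambda>n. z [^] n) ` {0..ord z - 1}) = p"
    using ord_inj[of z] z(1) ord prime_gt_0_nat[OF p] by (subst card_image) auto
  then have "(\<lambda>n. z [^] n) ` {0..ord z - 1} = P"
    using card_subset_eq[OF finP] pow P(2) by (metis image_subsetI)
  then have "P = range (\<lambda>n::nat. z [^] n)" using pow by blast
  then show thesis using that z ord by blast
qed

text \<open>Conjugation on \<open>P\<close> gives a character \<open>e\<close> modulo
  \<open>p\<close>, and the transfer gives \<open>v\<close> with
  \<open>v (g \<otimes> h) = v g + e g * v h\<close> modulo \<open>p\<close> and with
  \<open>v z\<close> the index of \<open>P\<close>, which is prime to \<open>p\<close>. On the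
  generators \<open>e\<close> is 1 or -1; \<open>v\<close> vanishes where \<open>e\<close> is 1 and
  has a constant value \<open>w\<close> where \<open>e\<close> is -1, so
  \<open>2 * v = w * (1 - e)\<close> on \<open>S\<close>. The relation extends to the whole group,
  and at \<open>z\<close>, where \<open>e\<close> is 1, it forces \<open>v z = 0\<close>.\<close>

lemma (in group) generated_by_involutions_no_normal_Hall_prime:
  assumes fin: "finite (carrier G)" and p: "prime p" "2 < p"
    and P: "P \<lhd> G" "card P = p" and np: "\<not> p dvd card (rcosets P)"
    and S: "S \<subseteq> carrier G" "generate G S = carrier G"
    and sq: "\<And>x. x \<in> S \<Longrightarrow> x \<otimes> x = \<one>"
    and rot: "\<And>x y. x \<in> S \<Longrightarrow> y \<in> S \<Longrightarrow> \<exists>k::nat. \<not> p dvd k \<and> (x \<otimes> y) [^] k = \<one>"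
  shows False
proof -
  interpret P: normal P G by fact
  obtain z where z: "z \<in> P" "ord z = p" and Pz: "P = range (\<lambda>n::nat. z [^] n)"
    using subgroup_prime_card_powers[OF p(1) P.subgroup_axioms P(2)] by metis
  have zc [simp]: "z \<in> carrier G" using z(1) by simp
  have zeq: "z [^] m = z [^] n \<longleftrightarrow> [m = n] (mod p)" for m n :: nat
    using int_pow_eq[OF zc, of "int m" "int n"] z(2)
    by (simp add: int_pow_int cong_iff_dvd_diff dvd_diff_commute[of _ "int n"] flip: cong_int_iff)

  define e where "e g = (SOME n::nat. g \<otimes> z \<otimes> inv g = z [^] n)" for g
  have e: "g \<otimes> z \<otimes> inv g = z [^] e g" if "g \<in> carrier G" for g
    unfolding e_def by (rule someI_ex) (use P.inv_op_closed2[OF that z(1)] Pz in auto)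
  have conj: "g \<otimes> z [^] n = z [^] (e g * n) \<otimes> g" if g: "g \<in> carrier G" for g and n :: nat
  proof (induction n)
    case (Suc n)
    have "g \<otimes> z = z [^] e g \<otimes> g" using e[OF g] g by (metis inv_solve_right m_closed nat_pow_closed zc)
    then have "g \<otimes> z [^] Suc n = z [^] (e g * n) \<otimes> (z [^] e g \<otimes> g)"
      using g Suc by (simp add: m_assoc flip: m_assoc) (simp add: m_assoc)
    then show ?case using g by (simp add: nat_pow_mult algebra_simps flip: m_assoc)
  qed (use g in simp)
  \<comment> \<open>\<open>e g\<close> is an arbitrary choice of exponent, determined only modulo
    \<open>p\<close>; hence a congruence and not an equality.\<close>
  have e_mult: "[e (g \<otimes> h) = e g * e h] (mod p)" if g: "g \<in> carrier G" and h: "h \<in> carrier G" for g h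
  proof -
    have "z [^] e (g \<otimes> h) \<otimes> (g \<otimes> h) = g \<otimes> (h \<otimes> z)"
      using conj[of "g \<otimes> h" 1] g h by (simp add: m_assoc)
    also have "\<dots> = (g \<otimes> z [^] e h) \<otimes> h" using conj[of h 1] g h by (simp add: m_assoc)
    also have "\<dots> = z [^] (e g * e h) \<otimes> (g \<otimes> h)" using conj[OF g] g h by (simp add: m_assoc)
    finally show ?thesis using g h by (simp flip: zeq)
  qed
  \<comment> \<open>\<open>P\<close> is commutative, so its own elements act trivially on
    it.\<close>
  have e_P: "[e (z [^] n) = 1] (mod p)" for n :: nat
  proof -
    have "z [^] e (z [^] n) \<otimes> z [^] n = z [^] n \<otimes> z" using conj[of "z [^] n" 1] by simp
    also have "\<dots> = z [^] (1::nat) \<otimes> z [^] n" using nat_pow_mult[of z n 1] nat_pow_mult[of z 1 n] by (simp add: add.commute)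
    finally show ?thesis by (simp del: nat_pow_eone flip: zeq)
  qed

  define rep where "rep g = (SOME h. h \<in> P #> g)" for g
  have rep: "rep g \<in> P #> g" if "g \<in> carrier G" for g
    unfolding rep_def using rcos_self[OF that P.subgroup_axioms] by (rule someI)
  have rep_c [simp]: "rep g \<in> carrier G" if "g \<in> carrier G" for g
    using rep[OF that] that r_coset_subset_G P.subset by blast
  have rep_coset: "P #> rep g = P #> g" if "g \<in> carrier G" for g
    using repr_independence[OF rep[OF that] that P.subgroup_axioms] by simp
  \<comment> \<open>\<open>rep g\<close> is chosen from the coset alone, so elements of one coset
    have literally the same representative.\<close>
  have rep_shift: "rep (z [^] n \<otimes> g) = rep g" if "g \<in> carrier G" for g and n :: nat
  proof -
    have "P #> z [^] n = P" using Pz by (intro coset_join2 P.subgroup_axioms) auto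
    then have "P #> (z [^] n \<otimes> g) = P #> g"
      using coset_mult_assoc[OF P.subset, of "z [^] n" g] that by simp
    then show ?thesis by (simp add: rep_def)
  qed
  define T where "T = rep ` carrier G"
  have T_c: "t \<in> carrier G" if "t \<in> T" for t using that by (auto simp: T_def)
  have T_rep: "rep t = t" if "t \<in> T" for t
    using that rep_coset unfolding T_def rep_def by fastforce
  have finT: "finite T" using fin by (simp add: T_def)
  have cardT: "\<not> p dvd card T"
  proof -
    have "(\<lambda>t. P #> t) ` T = rcosets P"
      using rep_coset by (force simp: T_def RCOSETS_def image_image)
    moreover have "inj_on (\<lambda>t. P #> t) T"
      using T_rep by (auto intro!: inj_onI simp: rep_def) (metis)
    ultimately show ?thesis using np by (metis card_image)
  qed

  define k where "k g t = (SOME n::nat. g \<otimes> t = z [^] n \<otimes> rep (g \<otimes> t))" for g t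
  have k: "g \<otimes> t = z [^] k g t \<otimes> rep (g \<otimes> t)" if "g \<in> carrier G" "t \<in> carrier G" for g t
  proof -
    have "g \<otimes> t \<in> P #> rep (g \<otimes> t)"
      using rep_coset[of "g \<otimes> t"] rcos_self[OF _ P.subgroup_axioms, of "g \<otimes> t"] that by simp
    then have "\<exists>n::nat. g \<otimes> t = z [^] n \<otimes> rep (g \<otimes> t)"
      by (auto simp: r_coset_def Pz)
    then show ?thesis unfolding k_def by (rule someI_ex)
  qed
  \<comment> \<open>The transfer puts powers of \<open>z\<close> on the right of the representatives; on the left they make \<open>v\<close>
    a crossed homomorphism, and \<open>v z\<close> does not cancel when some \<open>e g\<close> is \<open>-1\<close>.\<close>
  define v where "v g = (\<Sum>t\<in>T. k g t)" for g
  \<comment> \<open>Left multiplication respects right cosets because \<open>P\<close> is normal: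
    moving a power of \<open>z\<close> to the left of \<open>g\<close> only changes its
    exponent.\<close>
  have rep_rep: "rep (g \<otimes> rep (h \<otimes> t)) = rep (g \<otimes> (h \<otimes> t))"
    if "g \<in> carrier G" "h \<in> carrier G" "t \<in> carrier G" for g h t
  proof -
    have "g \<otimes> (h \<otimes> t) = z [^] (e g * k h t) \<otimes> (g \<otimes> rep (h \<otimes> t))"
      by (subst k[of h t]) (use that conj in \<open>simp_all add: m_assoc flip: m_assoc\<close>)
    then show ?thesis using rep_shift that by simp
  qed
  have k_mult: "[k (g \<otimes> h) t = e g * k h t + k g (rep (h \<otimes> t))] (mod p)"
    if g: "g \<in> carrier G" and h: "h \<in> carrier G" and t: "t \<in> carrier G" for g h t
  proof -
    let ?r = "rep (g \<otimes> (h \<otimes> t))"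
    have "z [^] k (g \<otimes> h) t \<otimes> ?r = g \<otimes> (h \<otimes> t)"
      using k[of "g \<otimes> h" t] g h t by (simp add: m_assoc)
    also have "\<dots> = (g \<otimes> z [^] k h t) \<otimes> rep (h \<otimes> t)"
      by (subst k[of h t]) (use g h t in \<open>simp_all add: m_assoc\<close>)
    also have "\<dots> = z [^] (e g * k h t) \<otimes> (g \<otimes> rep (h \<otimes> t))"
      using g h t by (simp add: conj m_assoc)
    also have "\<dots> = z [^] (e g * k h t) \<otimes> (z [^] k g (rep (h \<otimes> t)) \<otimes> ?r)"
      using k[of g "rep (h \<otimes> t)"] rep_rep g h t by simp
    also have "\<dots> = z [^] (e g * k h t + k g (rep (h \<otimes> t))) \<otimes> ?r"
      using g h t by (simp add: nat_pow_mult flip: m_assoc)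
    finally show ?thesis using g h t by (simp flip: zeq)
  qed
  have v_mult: "[v (g \<otimes> h) = v g + e g * v h] (mod p)"
    if g: "g \<in> carrier G" and h: "h \<in> carrier G" for g h
  proof -
    \<comment> \<open>Multiplication by \<open>h\<close> permutes the representatives, with
      \<open>inv h\<close> undoing it, so the second summand of \<open>k_mult\<close> sums over
      \<open>T\<close> to \<open>v g\<close>.\<close>
    have inj: "inj_on (\<lambda>t. rep (h \<otimes> t)) T"
    proof (rule inj_onI)
      fix t u assume tu: "t \<in> T" "u \<in> T" and "rep (h \<otimes> t) = rep (h \<otimes> u)"
      then have "rep (inv h \<otimes> (h \<otimes> t)) = rep (inv h \<otimes> (h \<otimes> u))"
        using rep_rep[of "inv h" h] h T_c by (metis inv_closed)
      then show "t = u" using tu h T_c T_rep by (simp flip: m_assoc)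
    qed
    have sub: "(\<lambda>t. rep (h \<otimes> t)) ` T \<subseteq> T" using h T_c by (auto simp: T_def)
    have img: "(\<lambda>t. rep (h \<otimes> t)) ` T = T" using endo_inj_surj[OF finT sub inj] .
    have "(\<Sum>t\<in>T. k g (rep (h \<otimes> t))) = v g"
      unfolding v_def by (subst (2) img[symmetric]) (simp add: sum.reindex[OF inj])
    moreover have "[v (g \<otimes> h) = (\<Sum>t\<in>T. e g * k h t + k g (rep (h \<otimes> t)))] (mod p)"
      unfolding v_def by (intro cong_sum k_mult g h T_c)
    ultimately show ?thesis by (simp add: v_def sum.distrib sum_distrib_left add.commute)
  qed
  \<comment> \<open>Multiplication by \<open>z\<close> fixes every coset of \<open>P\<close> and
    puts exactly one factor \<open>z\<close> before each representative.\<close>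
  have v_z: "[v z = card T] (mod p)"
  proof -
    have "[k z t = 1] (mod p)" if "t \<in> T" for t
    proof -
      have "z [^] k z t \<otimes> t = z [^] (1::nat) \<otimes> t"
        using k[of z t] rep_shift[of t 1] T_rep[OF that] T_c[OF that] by simp
      then show ?thesis using T_c[OF that] by (simp del: nat_pow_eone flip: zeq)
    qed
    then have "[v z = (\<Sum>t\<in>T. 1)] (mod p)" unfolding v_def by (rule cong_sum)
    then show ?thesis by simp
  qed

  define q where "q = int p"
  define E where "E g = int (e g)" for g
  define V where "V g = int (v g)" for g
  have E_mult: "[E (g \<otimes> h) = E g * E h] (mod q)" if "g \<in> carrier G" "h \<in> carrier G" for g h
    using e_mult[OF that] by (simp add: E_def q_def flip: cong_int_iff)
  have V_mult: "[V (g \<otimes> h) = V g + E g * V h] (mod q)" if "g \<in> carrier G" "h \<in> carrier G" for g h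
    using v_mult[OF that] by (simp add: E_def V_def q_def flip: cong_int_iff)
  have E_z: "[E z = 1] (mod q)" and E_1: "[E \<one> = 1] (mod q)"
    using e_P[of 1] e_P[of 0] by (simp_all add: E_def q_def flip: cong_int_iff)
  have V_1: "[V \<one> = 0] (mod q)"
  proof -
    have "[V \<one> = V \<one> + E \<one> * V \<one>] (mod q)" using V_mult[of \<one> \<one>] by simp
    also have "[V \<one> + E \<one> * V \<one> = V \<one> + 1 * V \<one>] (mod q)" by (intro cong_add cong_mult E_1 cong_refl)
    finally show ?thesis by (simp add: cong_iff_dvd_diff)
  qed
  have q: "prime q" using p by (simp add: q_def)
  have S_c: "x \<in> carrier G" if "x \<in> S" for x using that S(1) by blast
  have S_E: "[E x = 1] (mod q) \<or> [E x = -1] (mod q)" if x: "x \<in> S" for x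
  proof -
    have "[E x * E x = 1] (mod q)"
      using E_mult[of x x] E_1 sq[OF x] S_c[OF x] by (metis cong_sym cong_trans)
    then have "q dvd (E x - 1) * (E x + 1)" by (simp add: cong_iff_dvd_diff algebra_simps)
    then show ?thesis using q by (simp add: prime_dvd_mult_iff cong_iff_dvd_diff)
  qed
  have S_V: "q dvd V x * (1 + E x)" if x: "x \<in> S" for x
  proof -
    have "[V x + E x * V x = 0] (mod q)"
      using V_mult[of x x] V_1 sq[OF x] S_c[OF x] by (metis cong_sym cong_trans)
    then show ?thesis by (simp add: cong_0_iff algebra_simps)
  qed
  have not2: "\<not> q dvd 2" using p by (auto simp: q_def dest: zdvd_imp_le)
  \<comment> \<open>Here \<open>1 + E x\<close> is 2 modulo \<open>q\<close>, a unit because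
    \<open>p\<close> is odd, so \<open>S_V\<close> leaves only \<open>q dvd V x\<close>.\<close>
  have S_V0: "q dvd V x" if x: "x \<in> S" and E: "[E x = 1] (mod q)" for x
  proof -
    have "\<not> q dvd 1 + E x"
    proof
      assume "q dvd 1 + E x"
      moreover have "q dvd E x - 1" using E by (simp add: cong_iff_dvd_diff)
      ultimately have "q dvd (1 + E x) - (E x - 1)" by (rule dvd_diff)
      then show False using not2 by simp
    qed
    then show ?thesis using S_V[OF x] q by (simp add: prime_dvd_mult_iff)
  qed
  \<comment> \<open>Where \<open>E\<close> is 1 the twist disappears, and \<open>V\<close> is
    additive on powers.\<close>
  have V_pow: "[V (g [^] n) = int n * V g] (mod q)"
    if g: "g \<in> carrier G" and E: "[E g = 1] (mod q)" for g and n :: nat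
  proof (induction n)
    case (Suc n)
    have "[V (g [^] Suc n) = V g + E g * V (g [^] n)] (mod q)"
      using V_mult[of g "g [^] n"] g by (simp only: nat_pow_Suc2 nat_pow_closed)
    also have "[V g + E g * V (g [^] n) = V g + 1 * (int n * V g)] (mod q)"
      by (intro cong_add cong_mult cong_refl E Suc)
    finally show ?case by (simp add: algebra_simps)
  qed (simp add: V_1)
  have S_VV: "[V x = V y] (mod q)"
    if x: "x \<in> S" "[E x = -1] (mod q)" and y: "y \<in> S" "[E y = -1] (mod q)" for x y
  proof -
    \<comment> \<open>Both generators invert \<open>P\<close>, so their product centralizes it, and
      \<open>V\<close> of the product is \<open>V x - V y\<close>. Some power of the product with
      exponent prime to \<open>p\<close> is trivial, so this difference vanishes modulo
      \<open>q\<close>.\<close>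
    obtain n where n: "\<not> p dvd n" "(x \<otimes> y) [^] n = \<one>" using rot x y by blast
    have c: "x \<otimes> y \<in> carrier G" using S_c x y by simp
    have "[E (x \<otimes> y) = (-1) * (-1)] (mod q)"
      using E_mult[OF S_c[OF x(1)] S_c[OF y(1)]] cong_mult[OF x(2) y(2)] by (rule cong_trans)
    then have "[int n * V (x \<otimes> y) = 0] (mod q)"
      using V_pow[OF c, of n] n(2) V_1 by (simp) (metis cong_sym cong_trans)
    then have "q dvd V (x \<otimes> y)"
      using q n(1) by (simp add: cong_0_iff prime_dvd_mult_iff q_def)
    moreover have "[V (x \<otimes> y) = V x + (-1) * V y] (mod q)"
      using V_mult[OF S_c[OF x(1)] S_c[OF y(1)]]
      by (rule cong_trans) (intro cong_add cong_mult cong_refl x)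
    ultimately show ?thesis by (simp add: cong_iff_dvd_diff) (metis cong_dvd_iff cong_iff_dvd_diff)
  qed
  \<comment> \<open>\<open>w\<close> is the common value of \<open>V\<close> on the generators that
    invert \<open>P\<close>; if there are none, any \<open>w\<close> serves.\<close>
  obtain w where w: "\<And>x. x \<in> S \<Longrightarrow> [E x = -1] (mod q) \<Longrightarrow> [V x = w] (mod q)"
    using S_VV by metis
  \<comment> \<open>The right side is \<open>w\<close> times the principal crossed homomorphism
    \<open>1 - E x\<close>; the factor 2 on the left avoids a division modulo
    \<open>q\<close>.\<close>
  have S_all: "[2 * V x = w * (1 - E x)] (mod q)" if x: "x \<in> S" for x
  proof -
    from S_E[OF x] show ?thesis
    proof
      assume E: "[E x = 1] (mod q)"
      have "[w * (1 - E x) = w * (1 - 1)] (mod q)" by (intro cong_mult cong_diff cong_refl E)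
      moreover have "[2 * V x = 2 * 0] (mod q)"
        by (intro cong_mult cong_refl) (use S_V0[OF x E] in \<open>simp add: cong_0_iff\<close>)
      ultimately show ?thesis by (simp) (metis cong_sym cong_trans)
    next
      assume E: "[E x = -1] (mod q)"
      have "[w * (1 - E x) = w * (1 - (-1))] (mod q)" by (intro cong_mult cong_diff cong_refl E)
      moreover have "[2 * V x = 2 * w] (mod q)" by (intro cong_mult cong_refl w x E)
      ultimately show ?thesis by (simp add: mult.commute) (metis cong_sym cong_trans)
    qed
  qed
  \<comment> \<open>Both sides obey the same crossed product rule, so agreement on \<open>S\<close>
    propagates to all products.\<close>
  have all: "[2 * V g = w * (1 - E g)] (mod q)" if "g \<in> generate G S" for g
    using that
  proof (induction rule: generate.induct)
    case one
    have "[w * (1 - E \<one>) = w * (1 - 1)] (mod q)" by (intro cong_mult cong_diff cong_refl E_1)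
    moreover have "[2 * V \<one> = 2 * 0] (mod q)" by (intro cong_mult cong_refl V_1)
    ultimately show ?case by (simp) (metis cong_sym cong_trans)
  next
    case (incl x)
    then show ?case by (rule S_all)
  next
    case (inv x)
    have "inv x = x" using sq[OF inv] S_c[OF inv] by (metis inv_equality)
    then show ?case using S_all[OF inv] by simp
  next
    case (eng g h)
    have c: "g \<in> carrier G" "h \<in> carrier G" using eng generate_in_carrier[OF S(1)] by auto
    have "[2 * V (g \<otimes> h) = 2 * (V g + E g * V h)] (mod q)"
      by (intro cong_mult cong_refl V_mult c)
    also have "2 * (V g + E g * V h) = 2 * V g + E g * (2 * V h)" by (simp add: algebra_simps)
    also have "[\<dots> = w * (1 - E g) + E g * (w * (1 - E h))] (mod q)"
      by (intro cong_add cong_mult cong_refl eng)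
    also have "w * (1 - E g) + E g * (w * (1 - E h)) = w * (1 - E g * E h)" by (simp add: algebra_simps)
    also have "[\<dots> = w * (1 - E (g \<otimes> h))] (mod q)"
      by (intro cong_mult cong_diff cong_refl cong_sym[OF E_mult] c)
    finally show ?case .
  qed
  have "[2 * V z = w * (1 - E z)] (mod q)" using all S(2) by simp
  also have "[w * (1 - E z) = w * (1 - 1)] (mod q)" by (intro cong_mult cong_diff cong_refl E_z)
  finally have "q dvd 2 * V z" by (simp add: cong_0_iff)
  then have "q dvd V z" using q not2 by (simp add: prime_dvd_mult_iff)
  then have "p dvd v z" by (simp add: q_def V_def)
  then show False using v_z cardT by (metis cong_dvd_iff)
qed

section \<open>Quotients of triangle groups\<close>

text \<open>The product in the other order is the inverse. The relators mention each pair of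
  generators in one order only, and this supplies the other.\<close>

lemma (in group) pow_swapped_involutions_eq_one:
  assumes "x \<in> carrier G" "y \<in> carrier G" "x \<otimes> x = \<one>" "y \<otimes> y = \<one>" "(x \<otimes> y) [^] (n::nat) = \<one>"
  shows "(y \<otimes> x) [^] n = \<one>"
proof -
  have "inv x = x" "inv y = y" using assms by (simp_all add: inv_equality)
  then have "y \<otimes> x = inv (x \<otimes> y)" using assms by (simp add: inv_mult_group)
  then show ?thesis using assms by (simp add: nat_pow_inv)
qed

lemma word_class_relator:
  "u \<in> R \<Longrightarrow> word_rel R `` {u} = \<one>\<^bsub>presented_group R\<^esub>"
  using word_eq.relator[of u R "[]" "[]"] by (simp add: one_presented_group word_class_eq_iff)

lemma word_class_power:
  "word_rel R `` {word_power u n} = word_rel R `` {u} [^]\<^bsub>presented_group R\<^esub> n"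
proof -
  interpret group "presented_group R" by (rule group_presented_group)
  show ?thesis
  proof (induction n)
    case 0
    show ?case by (simp add: word_power_def one_presented_group)
  next
    case (Suc n)
    have "word_rel R `` {word_power u (Suc n)} =
        word_rel R `` {u} \<otimes>\<^bsub>presented_group R\<^esub> word_rel R `` {word_power u n}"
      by (simp add: word_power_def mult_presented_group)
    also have "\<dots> = word_rel R `` {u} [^]\<^bsub>presented_group R\<^esub> Suc n"
      by (subst nat_pow_Suc2) (auto simp: Suc carrier_presented_group)
    finally show ?case .
  qed
qed

lemma generate_presented_group:
  "generate (presented_group R) (range (\<lambda>x. word_rel R `` {[(x, True)]})) = carrier (presented_group R)"
    (is "generate ?G ?S = _")
proof -
  interpret group ?G by (rule group_presented_group)
  have S: "?S \<subseteq> carrier ?G" by (auto simp: carrier_presented_group)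
  have inv: "word_rel R `` {[(x, False)]} = inv\<^bsub>?G\<^esub> (word_rel R `` {[(x, True)]})" for x
  proof (rule inv_equality[symmetric])
    have "word_eq R ([] @ [(x, False), (x, \<not> False)] @ []) ([] @ [])" by (rule word_eq.cancel)
    then show "word_rel R `` {[(x, False)]} \<otimes>\<^bsub>?G\<^esub> word_rel R `` {[(x, True)]} = \<one>\<^bsub>?G\<^esub>"
      by (simp add: mult_presented_group one_presented_group word_class_eq_iff)
  qed (auto simp: carrier_presented_group)
  have "word_rel R `` {w} \<in> generate ?G ?S" for w
  proof (induction w)
    case Nil
    show ?case using generate.one[of ?G ?S] by (simp add: one_presented_group)
  next
    case (Cons l w)
    obtain x b where l: "l = (x, b)" by fastforce
    have "word_rel R `` {[l]} \<in> generate ?G ?S"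
      by (cases b) (auto simp: l inv intro: generate.incl generate.inv)
    then have "word_rel R `` {[l]} \<otimes>\<^bsub>?G\<^esub> word_rel R `` {w} \<in> generate ?G ?S"
      using Cons by (rule generate.eng)
    then show ?case by (simp add: mult_presented_group)
  qed
  then show ?thesis using generate_incl[OF S] by (auto simp: carrier_presented_group)
qed

text \<open>\<open>S\<close> consists of the images of the three generators. The exponent 1 serves a
  generator paired with itself; \<open>r\<close>, \<open>s\<close>, \<open>t\<close> serve the
  distinct pairs in either order.\<close>

lemma triangle_quotient_generators:
  assumes Q: "group Q" and f: "f \<in> epi (full_triangle_group r s t) Q"
  obtains S where "S \<subseteq> carrier Q" "generate Q S = carrier Q"
    "\<And>x. x \<in> S \<Longrightarrow> x \<otimes>\<^bsub>Q\<^esub> x = \<one>\<^bsub>Q\<^esub>"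
    "\<And>x y. x \<in> S \<Longrightarrow> y \<in> S \<Longrightarrow> \<exists>k\<in>{1, r, s, t}. (x \<otimes>\<^bsub>Q\<^esub> y) [^]\<^bsub>Q\<^esub> k = \<one>\<^bsub>Q\<^esub>"
proof -
  define R where "R = triangle_relators r s t"
  let ?G = "presented_group R"
  interpret Q: group Q by fact
  interpret f: group_hom ?G Q f
    using f Q by (auto simp: group_hom_def group_hom_axioms_def epi_def full_triangle_group_def R_def
        group_presented_group)
  define h where "h x = f (word_rel R `` {[(x, True)]})" for x
  have cl: "word_rel R `` {w} \<in> carrier ?G" for w by (auto simp: carrier_presented_group)
  have h: "h x \<in> carrier Q" for x by (simp add: h_def cl)
  have "f ` generate ?G (range (\<lambda>x. word_rel R `` {[(x, True)]})) = generate Q (range h)"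
    using f.generate_img[of "range (\<lambda>x. word_rel R `` {[(x, True)]})"] cl
    by (simp add: h_def[abs_def] image_image image_subset_iff)
  then have gen: "generate Q (range h) = carrier Q"
    using f by (simp add: generate_presented_group epi_def full_triangle_group_def R_def)
  have word: "f (word_rel R `` {w}) = \<one>\<^bsub>Q\<^esub>" if "w \<in> R" for w
    using word_class_relator[OF that] by simp
  have sq: "h x \<otimes>\<^bsub>Q\<^esub> h x = \<one>\<^bsub>Q\<^esub>" for x
  proof -
    have "word_power [(x, True)] 2 \<in> R"
      by (cases x) (auto simp: R_def triangle_relators_def Let_def)
    from word[OF this] show ?thesis
      by (simp add: word_class_power f.hom_nat_pow cl h_def[symmetric] numeral_2_eq_2 h)
  qed
  have pow: "(h x \<otimes>\<^bsub>Q\<^esub> h y) [^]\<^bsub>Q\<^esub> n = \<one>\<^bsub>Q\<^esub>"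
    if "word_power [(x, True), (y, True)] n \<in> R" for x y n
  proof -
    have "h x \<otimes>\<^bsub>Q\<^esub> h y = f (word_rel R `` {[(x, True), (y, True)]})"
      unfolding h_def by (subst f.hom_mult[symmetric]) (simp_all add: cl mult_presented_group)
    then show ?thesis using word[OF that] by (simp add: word_class_power f.hom_nat_pow cl)
  qed
  have ab: "(h gen_a \<otimes>\<^bsub>Q\<^esub> h gen_b) [^]\<^bsub>Q\<^esub> r = \<one>\<^bsub>Q\<^esub>"
    and bc: "(h gen_b \<otimes>\<^bsub>Q\<^esub> h gen_c) [^]\<^bsub>Q\<^esub> s = \<one>\<^bsub>Q\<^esub>"
    and ac: "(h gen_a \<otimes>\<^bsub>Q\<^esub> h gen_c) [^]\<^bsub>Q\<^esub> t = \<one>\<^bsub>Q\<^esub>"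
    by (rule pow, simp add: R_def triangle_relators_def Let_def)+
  note ba = Q.pow_swapped_involutions_eq_one[OF h h sq sq ab] and cb = Q.pow_swapped_involutions_eq_one[OF h h sq sq bc]
    and ca = Q.pow_swapped_involutions_eq_one[OF h h sq sq ac]
  have "\<exists>k\<in>{1, r, s, t}. (h x \<otimes>\<^bsub>Q\<^esub> h y) [^]\<^bsub>Q\<^esub> k = \<one>\<^bsub>Q\<^esub>" for x y
    by (cases x; cases y) (use ab bc ac ba cb ca sq h in auto)
  then show thesis using that[of "range h"] h gen sq by blast
qed

text \<open>Otherwise a Sylow subgroup of order \<open>p\<close> would be normal with index prime to
  \<open>p\<close>, which is impossible for a group generated by such involutions.\<close>

lemma not_order_of_triangle_quotient:
  assumes n: "n \<in> finite_quotient_orders (full_triangle_group r s t)"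
    and pos: "0 < r" "0 < s" "0 < t"
    and p: "prime p" "2 < p" "r < p" "s < p" "t < p" and dvd: "p dvd n" "\<not> p\<^sup>2 dvd n"
  shows "\<exists>d. d dvd n \<and> [d = 1] (mod p) \<and> d \<noteq> 1"
proof (rule ccontr)
  assume "\<not> ?thesis"
  then have div: "d = 1" if "d dvd n" "[d = 1] (mod p)" for d using that by blast
  obtain Q :: "nat monoid" and f where Q: "group Q" "finite (carrier Q)"
    and f: "f \<in> epi (full_triangle_group r s t) Q" and ord: "order Q = n"
    using n by (auto simp: finite_quotient_orders_def)
  interpret Q: group Q by fact
  obtain S where S: "S \<subseteq> carrier Q" "generate Q S = carrier Q"
    "\<And>x. x \<in> S \<Longrightarrow> x \<otimes>\<^bsub>Q\<^esub> x = \<one>\<^bsub>Q\<^esub>"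
    "\<And>x y. x \<in> S \<Longrightarrow> y \<in> S \<Longrightarrow> \<exists>k\<in>{1, r, s, t}. (x \<otimes>\<^bsub>Q\<^esub> y) [^]\<^bsub>Q\<^esub> k = \<one>\<^bsub>Q\<^esub>"
    using triangle_quotient_generators[OF Q(1) f] by metis
  have rot: "\<exists>k::nat. \<not> p dvd k \<and> (x \<otimes>\<^bsub>Q\<^esub> y) [^]\<^bsub>Q\<^esub> k = \<one>\<^bsub>Q\<^esub>" if "x \<in> S" "y \<in> S" for x y
  proof -
    obtain k where k: "k \<in> {1, r, s, t}" "(x \<otimes>\<^bsub>Q\<^esub> y) [^]\<^bsub>Q\<^esub> k = \<one>\<^bsub>Q\<^esub>"
      using S(4)[OF \<open>x \<in> S\<close> \<open>y \<in> S\<close>] by blast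
    \<comment> \<open>A positive exponent below \<open>p\<close> is prime to \<open>p\<close>,
      whereas 0 would be divisible by it.\<close>
    then have "0 < k" "k < p" using p pos by auto
    then show ?thesis using k(2) by (metis dvd_imp_le leD)
  qed
  obtain m where m: "n = p * m" using dvd(1) by (rule dvdE)
  obtain P where P: "subgroup P Q" "card P = p"
    using sylow_thm[OF p(1) Q(1) _ Q(2), of 1 m] ord m by auto
  have normal: "P \<lhd> Q"
    by (rule Q.normal_if_no_divisor_cong_1[OF Q(2) p(1) P]) (use ord dvd div in auto)
  have "card (rcosets\<^bsub>Q\<^esub> P) * p = n" using Q.lagrange[OF P(1)] P(2) ord by simp
  then have "\<not> p dvd card (rcosets\<^bsub>Q\<^esub> P)"
    using dvd(2) by (auto simp: power2_eq_square)
  then show False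
    using Q.generated_by_involutions_no_normal_Hall_prime[OF Q(2) p(1,2) normal P(2) _ S(1-3) rot]
    by blast
qed

section \<open>Counting\<close>

lemma card_multiples_le:
  fixes d x :: nat
  assumes "0 < d"
  shows "real (card {n \<in> {1..x}. d dvd n}) \<le> real x / real d"
proof -
  have "{n \<in> {1..x}. d dvd n} \<subseteq> (\<lambda>k. d * k) ` {1..x div d}"
  proof
    fix n assume n: "n \<in> {n \<in> {1..x}. d dvd n}"
    then obtain k where "n = d * k" by (auto elim: dvdE)
    moreover from this have "1 \<le> k" using n by (cases k) auto
    moreover have "k \<le> x div d"
      using n assms \<open>n = d * k\<close> by (simp add: less_eq_div_iff_mult_less_eq mult.commute)
    ultimately show "n \<in> (\<lambda>k. d * k) ` {1..x div d}" by auto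
  qed
  then have "card {n \<in> {1..x}. d dvd n} \<le> card {1..x div d}"
    by (meson card_image_le card_mono finite_atLeastAtMost finite_imageI le_trans)
  then have "card {n \<in> {1..x}. d dvd n} \<le> x div d" by simp
  also have "real (x div d) \<le> real x / real d" by (rule of_nat_div_le_of_nat)
  finally show ?thesis by simp
qed

text \<open>Each new term satisfies \<open>1 / (n + 1) \<le> ln (n + 1) - ln n\<close>, which is
  \<open>ln u \<le> u - 1\<close> at \<open>u = n / (n + 1)\<close>.\<close>

lemma sum_inverse_le_ln: "(\<Sum>k=1..n. 1 / real k) \<le> 1 + ln (real n)"
proof (induction n)
  case (Suc n)
  show ?case
  proof (cases "n = 0")
    case False
    have "ln (real n / real (Suc n)) \<le> real n / real (Suc n) - 1"
      using False by (intro ln_le_minus_one) simp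
    also have "\<dots> = - 1 / real (Suc n)" by (simp add: field_simps)
    finally have "1 / real (Suc n) \<le> ln (real (Suc n)) - ln (real n)"
      using False by (simp add: ln_div)
    then show ?thesis using Suc by simp
  qed simp
qed simp

text \<open>The sum telescopes after
  \<open>1 / (n + 1)\<^sup>2 \<le> 1 / n - 1 / (n + 1)\<close>.\<close>

lemma sum_inverse_squares_le:
  assumes "0 < y"
  shows "(\<Sum>p\<in>{y<..x}. 1 / (real p)\<^sup>2) \<le> 1 / real y"
proof (cases "y \<le> x")
  case True
  then have "(\<Sum>p\<in>{y<..x}. 1 / (real p)\<^sup>2) \<le> 1 / real y - 1 / real x"
  proof (induction x rule: dec_induct)
    case (step n)
    have "1 / (real (Suc n))\<^sup>2 \<le> 1 / (real n * real (Suc n))"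
      using step assms by (intro divide_left_mono) (auto simp: power2_eq_square)
    also have "\<dots> = 1 / real n - 1 / real (Suc n)"
      using step assms by (simp add: field_simps)
    finally have "1 / (real (Suc n))\<^sup>2 \<le> 1 / real n - 1 / real (Suc n)" .
    moreover have "{y<..Suc n} = insert (Suc n) {y<..n}" using step by auto
    ultimately show ?case using step.IH by simp
  qed simp
  also have "\<dots> \<le> 1 / real y" by simp
  finally show ?thesis .
qed simp

text \<open>A union bound over \<open>p\<close>: each \<open>p\<^sup>2\<close> has at most
  \<open>x / p\<^sup>2\<close> multiples up to \<open>x\<close>, and the inverse squares beyond
  \<open>y\<close> sum to at most \<open>1 / y\<close>.\<close>

lemma card_square_divisible_le:
  assumes "0 < y"
  shows "real (card {n \<in> {1..x}. \<exists>p>y. p\<^sup>2 dvd n}) \<le> real x / real y"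
proof -
  have "{n \<in> {1..x}. \<exists>p>y. p\<^sup>2 dvd n} \<subseteq> (\<Union>p\<in>{y<..x}. {n \<in> {1..x}. p\<^sup>2 dvd n})"
  proof clarify
    fix n p assume n: "n \<in> {1..x}" and p: "y < p" "p\<^sup>2 dvd n"
    have "p \<le> p\<^sup>2" by (simp add: power2_nat_le_imp_le power2_eq_square)
    also have "p\<^sup>2 \<le> n" using n p by (intro dvd_imp_le) auto
    finally show "n \<in> (\<Union>p\<in>{y<..x}. {n \<in> {1..x}. p\<^sup>2 dvd n})" using n p by auto
  qed
  then have "card {n \<in> {1..x}. \<exists>p>y. p\<^sup>2 dvd n} \<le> card (\<Union>p\<in>{y<..x}. {n \<in> {1..x}. p\<^sup>2 dvd n})"
    by (intro card_mono) auto
  also have "\<dots> \<le> (\<Sum>p\<in>{y<..x}. card {n \<in> {1..x}. p\<^sup>2 dvd n})" by (rule card_UN_le) simp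
  finally have "real (card {n \<in> {1..x}. \<exists>p>y. p\<^sup>2 dvd n})
      \<le> (\<Sum>p\<in>{y<..x}. real (card {n \<in> {1..x}. p\<^sup>2 dvd n}))"
    by (simp flip: of_nat_sum)
  also have "\<dots> \<le> (\<Sum>p\<in>{y<..x}. real x * (1 / (real p)\<^sup>2))"
  proof (rule sum_mono)
    fix p assume "p \<in> {y<..x}"
    then show "real (card {n \<in> {1..x}. p\<^sup>2 dvd n}) \<le> real x * (1 / (real p)\<^sup>2)"
      using card_multiples_le[of "p\<^sup>2" x] by simp
  qed
  also have "\<dots> \<le> real x * (1 / real y)"
    using sum_inverse_squares_le[OF assms] by (simp only: flip: sum_distrib_left) (rule mult_left_mono, auto)
  finally show ?thesis by simp
qed

text \<open>Such a \<open>d\<close> is \<open>1 + k * p\<close> with \<open>k \<ge> 1\<close> and is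
  coprime to \<open>p\<close>, so \<open>n\<close> is a multiple of \<open>p * (1 + k * p)\<close>,
  which exceeds \<open>k * p\<^sup>2\<close>. Summing \<open>x / (k * p\<^sup>2)\<close> gives a
  factor \<open>1 / y\<close> from \<open>p\<close> and a harmonic sum from
  \<open>k\<close>.\<close>

lemma card_divisor_cong_1_le:
  assumes "0 < y"
  shows "real (card {n \<in> {1..x}. \<exists>p>y. p dvd n \<and> (\<exists>d. d dvd n \<and> [d = 1] (mod p) \<and> d \<noteq> 1)})
    \<le> real x * (1 + ln (real x)) / real y" (is "real (card ?A) \<le> _")
proof -
  let ?B = "\<lambda>p k. {n \<in> {1..x}. p * (1 + k * p) dvd n}"
  have "?A \<subseteq> (\<Union>p\<in>{y<..x}. \<Union>k\<in>{1..x}. ?B p k)"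
  proof clarify
    fix n p d assume n: "n \<in> {1..x}" and p: "y < p" "p dvd n" and d: "d dvd n" "[d = 1] (mod p)" "d \<noteq> 1"
    have "0 < d" using d n by (auto intro: Nat.gr0I)
    then obtain k where k: "d = 1 + k * p"
      using cong_le_nat[of 1 d p] d(2) by (auto simp: cong_sym_eq)
    have "coprime p d"
      using d(2) cong_imp_coprime[of 1 d p] by (simp add: cong_sym_eq coprime_commute)
    then have dv: "p * (1 + k * p) dvd n" using divides_mult[OF p(2) d(1)] k by simp
    have "p \<le> n" "d \<le> n" using n p d by (auto intro: dvd_imp_le)
    moreover have "k \<le> k * p" using p by simp
    moreover have "k \<noteq> 0" using k d by auto
    ultimately have "1 \<le> k" "k \<le> x" "p \<le> x"
      using n k unfolding atLeastAtMost_iff by linarith+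
    then have "p \<in> {y<..x}" "k \<in> {1..x}" using p by auto
    then show "n \<in> (\<Union>p\<in>{y<..x}. \<Union>k\<in>{1..x}. ?B p k)" using n dv by blast
  qed
  then have "card ?A \<le> card (\<Union>p\<in>{y<..x}. \<Union>k\<in>{1..x}. ?B p k)"
    by (intro card_mono) auto
  also have "\<dots> \<le> (\<Sum>p\<in>{y<..x}. card (\<Union>k\<in>{1..x}. ?B p k))" by (rule card_UN_le) simp
  also have "\<dots> \<le> (\<Sum>p\<in>{y<..x}. \<Sum>k\<in>{1..x}. card (?B p k))"
    by (intro sum_mono card_UN_le) simp
  finally have "real (card ?A) \<le> (\<Sum>p\<in>{y<..x}. \<Sum>k\<in>{1..x}. real (card (?B p k)))"
    by (simp flip: of_nat_sum)
  also have "\<dots> \<le> (\<Sum>p\<in>{y<..x}. \<Sum>k\<in>{1..x}. real x * (1 / (real p)\<^sup>2 * (1 / real k)))"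
  proof (intro sum_mono)
    fix p k assume pk: "p \<in> {y<..x}" "k \<in> {1..x}"
    have "real (card (?B p k)) \<le> real x / real (p * (1 + k * p))"
      using pk by (intro card_multiples_le) auto
    also have "\<dots> \<le> real x / (real p * (real k * real p))"
      using pk by (intro divide_left_mono mult_pos_pos) (auto simp: algebra_simps add_pos_nonneg)
    finally show "real (card (?B p k)) \<le> real x * (1 / (real p)\<^sup>2 * (1 / real k))"
      by (simp add: power2_eq_square mult_ac)
  qed
  also have "\<dots> = real x * ((\<Sum>p\<in>{y<..x}. 1 / (real p)\<^sup>2) * (\<Sum>k\<in>{1..x}. 1 / real k))"
    by (simp only: sum_product flip: sum_distrib_left)
  also have "\<dots> \<le> real x * (1 / real y * (1 + ln (real x)))"
    by (intro mult_left_mono mult_mono sum_inverse_squares_le sum_inverse_le_ln assms sum_nonneg) auto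
  finally show ?thesis by simp
qed

text \<open>The multiplicity counts the \<open>k \<ge> 1\<close> with \<open>p ^ k dvd n\<close>.
  Exchanging the sums leaves the geometric series of the \<open>x / p ^ k\<close>, at most
  \<open>2 * x / p\<close> because \<open>p \<ge> 2\<close>.\<close>

lemma sum_multiplicity_le:
  assumes "prime p"
  shows "(\<Sum>n=1..x. real (multiplicity p n)) \<le> 2 * real x / real p"
proof -
  have p: "2 \<le> p" using assms by (rule prime_ge_2_nat)
  have mult: "real (multiplicity p n) = (\<Sum>k=1..x. if p ^ k dvd n then 1 else 0)" if n: "n \<in> {1..x}" for n
  proof -
    \<comment> \<open>The multiplicity is at most \<open>x\<close>, so one range of exponents serves
      all \<open>n\<close> and the sums can be exchanged.\<close>
    have "p ^ multiplicity p n \<le> n" using n by (intro dvd_imp_le multiplicity_dvd) auto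
    moreover have "multiplicity p n < p ^ multiplicity p n" using p by (simp add: power_gt_expt)
    ultimately have le: "multiplicity p n \<le> x" using n by simp
    have iff: "p ^ k dvd n \<longleftrightarrow> k \<le> multiplicity p n" for k
      using n p by (intro power_dvd_iff_le_multiplicity) auto
    have "{k \<in> {1..x}. p ^ k dvd n} = {1..multiplicity p n}"
      unfolding iff using le by (auto intro: order_trans)
    then have "{1..x} \<inter> {k. p ^ k dvd n} = {1..multiplicity p n}" by blast
    then show ?thesis by (simp only: sum.If_cases finite_atLeastAtMost) simp
  qed
  \<comment> \<open>The subtracted term makes the induction close; its step amounts to
    \<open>2 * u \<le> 1\<close> for \<open>u = 1 / p\<close>.\<close>
  have geom: "(\<Sum>k=1..x. (1 / real p) ^ k) \<le> 2 / real p - 2 * (1 / real p) ^ x / real p"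
  proof (induction x)
    case (Suc x)
    define u where "u = 1 / real p"
    have "u ^ x * (u * (2 * u)) \<le> u ^ x * (u * 1)"
      using p by (intro mult_left_mono) (auto simp: u_def)
    moreover have "(\<Sum>k=1..x. u ^ k) \<le> 2 * u - 2 * u ^ x * u" using Suc by (simp add: u_def)
    ultimately have "(\<Sum>k=1..Suc x. u ^ k) \<le> 2 * u - 2 * u ^ Suc x * u" by (simp add: algebra_simps)
    then show ?case by (simp add: u_def)
  qed (use p in \<open>simp add: field_simps\<close>)
  have "(\<Sum>n=1..x. real (multiplicity p n)) = (\<Sum>n=1..x. \<Sum>k=1..x. if p ^ k dvd n then 1 else 0)"
    by (intro sum.cong HOL.refl mult)
  also have "\<dots> = (\<Sum>k=1..x. \<Sum>n=1..x. if p ^ k dvd n then 1 else 0)" by (rule sum.swap)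
  also have "\<dots> = (\<Sum>k=1..x. real (card {n \<in> {1..x}. p ^ k dvd n}))"
    by (simp add: sum.If_cases Int_def)
  also have "\<dots> \<le> (\<Sum>k=1..x. real x * (1 / real p) ^ k)"
  proof (rule sum_mono)
    fix k show "real (card {n \<in> {1..x}. p ^ k dvd n}) \<le> real x * (1 / real p) ^ k"
      using card_multiples_le[of "p ^ k" x] p by (simp add: power_one_over divide_inverse power_inverse)
  qed
  also have "\<dots> = real x * (\<Sum>k=1..x. (1 / real p) ^ k)" by (simp add: sum_distrib_left)
  also have "\<dots> \<le> real x * (2 / real p)"
  proof (rule mult_left_mono)
    have "(\<Sum>k=1..x. (1 / real p) ^ k) \<le> 2 / real p - 2 * (1 / real p) ^ x / real p" by (rule geom)
    also have "\<dots> \<le> 2 / real p" by simp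
    finally show "(\<Sum>k=1..x. (1 / real p) ^ k) \<le> 2 / real p" .
  qed simp
  finally show ?thesis by (simp add: mult.commute)
qed

lemma ln_eq_sum_multiplicity:
  fixes n :: nat
  assumes "0 < n"
  shows "ln (real n) = (\<Sum>p\<in>prime_factors n. real (multiplicity p n) * ln (real p))"
proof -
  have "real n = (\<Prod>p\<in>prime_factors n. real p ^ multiplicity p n)"
    using prod_prime_factors[of n] assms by (metis (no_types, lifting) normalize_nat_def of_nat_power of_nat_prod prod.cong id_apply neq0_conv)
  then have "ln (real n) = ln (\<Prod>p\<in>prime_factors n. real p ^ multiplicity p n)" by simp
  also have "\<dots> = (\<Sum>p\<in>prime_factors n. ln (real p ^ multiplicity p n))"
    by (rule ln_prod) (auto simp: in_prime_factors_iff prime_gt_0_nat)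
  also have "\<dots> = (\<Sum>p\<in>prime_factors n. real (multiplicity p n) * ln (real p))"
    by (intro sum.cong HOL.refl) (auto simp: in_prime_factors_iff prime_gt_0_nat ln_realpow)
  finally show ?thesis .
qed

text \<open>Numbers up to \<open>sqrt x\<close> are counted trivially. A smooth
  \<open>n > sqrt x\<close> has \<open>ln x / 2 \<le> ln n\<close>, and \<open>ln n\<close> is at
  most \<open>ln y\<close> times the total multiplicity in \<open>n\<close> of the primes up to
  \<open>y\<close>. That total averages at most \<open>2 * (1 + ln y)\<close> over all
  \<open>n \<le> x\<close>, so Markov's inequality bounds the number of such
  \<open>n\<close>.\<close>

lemma card_smooth_le:
  assumes x: "1 < x" and y: "2 \<le> y"
  shows "real (card {n \<in> {1..x}. \<forall>p. prime p \<longrightarrow> p dvd n \<longrightarrow> p \<le> y})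
    \<le> sqrt (real x) + 4 * real x * ln (real y) * (1 + ln (real y)) / ln (real x)" (is "real (card ?A) \<le> _")
proof -
  define P where "P = {p \<in> {1..y}. prime p}"
  define B where "B = {n \<in> ?A. sqrt (real x) < real n}"
  have "?A \<subseteq> {1..nat \<lfloor>sqrt (real x)\<rfloor>} \<union> B"
    by (auto simp: B_def not_less le_nat_iff le_floor_iff)
  then have "card ?A \<le> card ({1..nat \<lfloor>sqrt (real x)\<rfloor>} \<union> B)" by (rule card_mono[rotated]) (simp add: B_def)
  also have "\<dots> \<le> card {1..nat \<lfloor>sqrt (real x)\<rfloor>} + card B" by (rule card_Un_le)
  finally have "real (card ?A) \<le> real (nat \<lfloor>sqrt (real x)\<rfloor>) + real (card B)"
    unfolding card_atLeastAtMost by linarith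
  moreover have "real (nat \<lfloor>sqrt (real x)\<rfloor>) \<le> sqrt (real x)" by simp
  ultimately have A: "real (card ?A) \<le> sqrt (real x) + real (card B)" by linarith
  have "ln (real x) / 2 \<le> ln (real y) * (\<Sum>p\<in>P. real (multiplicity p n))" if n: "n \<in> B" for n
  proof -
    have n0: "0 < n" "prime_factors n \<subseteq> P"
      using n by (auto simp: B_def P_def in_prime_factors_iff prime_ge_1_nat Suc_le_eq prime_gt_0_nat)
    have "ln (real x) / 2 = ln (sqrt (real x))" using x by (simp add: ln_sqrt)
    also have "\<dots> \<le> ln (real n)" using n x by (simp add: B_def)
    also have "\<dots> = (\<Sum>p\<in>prime_factors n. real (multiplicity p n) * ln (real p))"
      using n0(1) by (rule ln_eq_sum_multiplicity)
    also have "\<dots> \<le> (\<Sum>p\<in>prime_factors n. real (multiplicity p n) * ln (real y))"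
      using n0 by (intro sum_mono mult_left_mono) (auto simp: P_def subset_iff)
    also have "\<dots> \<le> (\<Sum>p\<in>P. real (multiplicity p n) * ln (real y))"
      using n0 y by (intro sum_mono2) (auto simp: P_def)
    finally show ?thesis by (simp add: sum_distrib_left mult.commute)
  qed
  then have "(\<Sum>n\<in>B. ln (real x) / 2) \<le> (\<Sum>n\<in>B. ln (real y) * (\<Sum>p\<in>P. real (multiplicity p n)))"
    by (rule sum_mono)
  also have "\<dots> \<le> (\<Sum>n=1..x. ln (real y) * (\<Sum>p\<in>P. real (multiplicity p n)))"
    using y by (intro sum_mono2) (auto simp: B_def intro!: mult_nonneg_nonneg sum_nonneg)
  also have "\<dots> = ln (real y) * (\<Sum>p\<in>P. \<Sum>n=1..x. real (multiplicity p n))"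
    by (subst sum.swap) (simp add: sum_distrib_left)
  also have "\<dots> \<le> ln (real y) * (\<Sum>p\<in>P. 2 * real x * (1 / real p))"
    using y sum_multiplicity_le by (intro mult_left_mono sum_mono) (auto simp: P_def)
  also have "\<dots> \<le> ln (real y) * (2 * real x * (1 + ln (real y)))"
  proof (rule mult_left_mono)
    have "(\<Sum>p\<in>P. 1 / real p) \<le> (\<Sum>p=1..y. 1 / real p)" by (intro sum_mono2) (auto simp: P_def)
    also have "\<dots> \<le> 1 + ln (real y)" by (rule sum_inverse_le_ln)
    finally show "(\<Sum>p\<in>P. 2 * real x * (1 / real p)) \<le> 2 * real x * (1 + ln (real y))"
      by (simp only: flip: sum_distrib_left) (rule mult_left_mono, auto)
  qed (use y in auto)
  finally have "real (card B) * ln (real x) \<le> 4 * real x * ln (real y) * (1 + ln (real y))"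
    by (simp add: algebra_simps)
  then have "real (card B) \<le> 4 * real x * ln (real y) * (1 + ln (real y)) / ln (real x)"
    using x by (simp add: pos_le_divide_eq)
  then show ?thesis using A by linarith
qed

text \<open>An element of \<open>F\<close> is either \<open>y\<close>-smooth or divisible by a prime
  \<open>p > y\<close>; in the latter case \<open>p\<^sup>2\<close> divides it or it has a
  nontrivial divisor congruent to 1 modulo \<open>p\<close>. The three kinds are counted
  separately.\<close>

lemma density_zero_if_divisor_cong_1:
  fixes F :: "nat set" and c :: nat
  assumes F: "\<And>n p. n \<in> F \<Longrightarrow> prime p \<Longrightarrow> c < p \<Longrightarrow> p dvd n \<Longrightarrow> \<not> p\<^sup>2 dvd n \<Longrightarrow>
    \<exists>d. d dvd n \<and> [d = 1] (mod p) \<and> d \<noteq> 1"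
  shows "(\<lambda>x::nat. real (card (F \<inter> {1..x})) / real x) \<longlonglongrightarrow> 0"
proof -
  \<comment> \<open>\<open>b u\<close> is the sum of the three bounds divided by \<open>u\<close>,
    with \<open>ln y\<close> replaced by \<open>2 * ln (ln u)\<close> and \<open>1 / y\<close> by
    \<open>1 / ((ln u)\<^sup>2 - 1)\<close>, which absorbs the rounding of \<open>y\<close>.\<close>
  define b where "b u = 1 / sqrt u + 4 * (2 * ln (ln u)) * (1 + 2 * ln (ln u)) / ln u
    + (2 + ln u) / ((ln u)\<^sup>2 - 1)" for u :: real
  have bound: "real (card (F \<inter> {1..x})) / real x \<le> b (real x)"
    if big: "real c + 2 < (ln (real x))\<^sup>2 - 1" and lnx: "1 < ln (real x)" for x
  proof -
    \<comment> \<open>This \<open>y\<close> outgrows \<open>ln x\<close>, which makes the two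
      divisibility counts negligible, while \<open>(ln y)\<^sup>2\<close> stays negligible against
      \<open>ln x\<close>, as the smooth count requires.\<close>
    define y where "y = nat \<lfloor>(ln (real x))\<^sup>2\<rfloor>"
    have y: "real y \<le> (ln (real x))\<^sup>2" "(ln (real x))\<^sup>2 - 1 < real y"
    proof -
      have "real y = real_of_int \<lfloor>(ln (real x))\<^sup>2\<rfloor>" by (simp add: y_def)
      then show "real y \<le> (ln (real x))\<^sup>2" "(ln (real x))\<^sup>2 - 1 < real y" by linarith+
    qed
    have cy: "c \<le> y" "2 \<le> y" "0 < y" using y big by linarith+
    have x: "1 < x" using lnx by (cases "x = 0 \<or> x = 1") auto
    let ?A = "{n \<in> {1..x}. \<forall>p. prime p \<longrightarrow> p dvd n \<longrightarrow> p \<le> y}"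
    let ?B = "{n \<in> {1..x}. \<exists>p>y. p\<^sup>2 dvd n}"
    let ?C = "{n \<in> {1..x}. \<exists>p>y. p dvd n \<and> (\<exists>d. d dvd n \<and> [d = 1] (mod p) \<and> d \<noteq> 1)}"
    have "F \<inter> {1..x} \<subseteq> ?A \<union> (?B \<union> ?C)"
    proof
      fix n assume n: "n \<in> F \<inter> {1..x}"
      show "n \<in> ?A \<union> (?B \<union> ?C)"
      proof (cases "n \<in> ?A")
        case False
        then obtain p where p: "prime p" "p dvd n" "y < p" using n by auto
        then show ?thesis using F[of n p] n cy by (cases "p\<^sup>2 dvd n") auto
      qed simp
    qed
    then have "card (F \<inter> {1..x}) \<le> card (?A \<union> (?B \<union> ?C))" by (rule card_mono[rotated]) simp
    also have "\<dots> \<le> card ?A + (card ?B + card ?C)"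
      by (rule order_trans[OF card_Un_le add_left_mono[OF card_Un_le]])
    finally have "real (card (F \<inter> {1..x})) \<le> real (card ?A) + (real (card ?B) + real (card ?C))" by simp
    also have "\<dots> \<le> (sqrt (real x) + 4 * real x * ln (real y) * (1 + ln (real y)) / ln (real x))
        + (real x / real y + real x * (1 + ln (real x)) / real y)"
      by (intro add_mono card_smooth_le card_square_divisible_le card_divisor_cong_1_le x cy)
    also have "\<dots> = real x * (sqrt (real x) / real x + 4 * ln (real y) * (1 + ln (real y)) / ln (real x)
        + (2 + ln (real x)) / real y)"
      using x by (simp add: algebra_simps add_divide_distrib)
    also have "\<dots> \<le> real x * b (real x)"
    proof (rule mult_left_mono)
      have "ln (real y) \<le> ln ((ln (real x))\<^sup>2)" by (rule ln_mono) (use y cy in auto)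
      also have "\<dots> = 2 * ln (ln (real x))" using lnx by (simp add: ln_realpow)
      finally have "ln (real y) \<le> 2 * ln (ln (real x))" .
      moreover have "0 \<le> ln (real y)" using cy by simp
      ultimately have "4 * ln (real y) * (1 + ln (real y)) / ln (real x)
          \<le> 4 * (2 * ln (ln (real x))) * (1 + 2 * ln (ln (real x))) / ln (real x)"
        using lnx by (intro divide_right_mono mult_mono) auto
      moreover have "(2 + ln (real x)) / real y \<le> (2 + ln (real x)) / ((ln (real x))\<^sup>2 - 1)"
        using y big lnx by (intro divide_left_mono) auto
      moreover have "sqrt (real x) / real x = 1 / sqrt (real x)"
        using x by (simp add: field_simps)
      ultimately show "sqrt (real x) / real x + 4 * ln (real y) * (1 + ln (real y)) / ln (real x)
        + (2 + ln (real x)) / real y \<le> b (real x)" by (simp add: b_def)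
    qed simp
    finally show ?thesis using x by (simp add: divide_le_eq mult.commute)
  qed
  have "eventually (\<lambda>x::nat. real c + 2 < (ln (real x))\<^sup>2 - 1) sequentially" by real_asymp
  moreover have "eventually (\<lambda>x::nat. 1 < ln (real x)) sequentially" by real_asymp
  ultimately have ev: "eventually (\<lambda>x. real (card (F \<inter> {1..x})) / real x \<le> b (real x)) sequentially"
    by eventually_elim (rule bound)
  have "(\<lambda>x::nat. b (real x)) \<longlonglongrightarrow> 0" unfolding b_def by real_asymp
  then show ?thesis by (rule tendsto_sandwich[OF _ ev tendsto_const, rotated]) (simp add: always_eventually)
qed

theorem corollary1:
  fixes r s t :: nat
  assumes "r > 0" and "s > 0" and "t > 0"
  shows "has_natural_density (finite_quotient_orders (full_triangle_group r s t)) 0"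
  unfolding has_natural_density_def
proof (rule density_zero_if_divisor_cong_1)
  fix n p :: nat
  \<comment> \<open>The threshold \<open>c\<close> is \<open>r + s + t\<close>: a prime above it
    exceeds each of \<open>r\<close>, \<open>s\<close>, \<open>t\<close>, and also 2 because all
    three are positive.\<close>
  assume "n \<in> finite_quotient_orders (full_triangle_group r s t)" "prime p" "r + s + t < p"
    "p dvd n" "\<not> p\<^sup>2 dvd n"
  then show "\<exists>d. d dvd n \<and> [d = 1] (mod p) \<and> d \<noteq> 1"
    using assms by (intro not_order_of_triangle_quotient[of n r s t p]) auto
qed

end
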